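(* Let $\mathfrak{C}$ be a covariance model. Let $T$ be a nonsphericity-corrected F-type test statistic based on $\check\beta$ and $\check\Omega$, where $(\check\beta,\check\Omega,N)$ satisfies the estimator conditions with $N=\emptyset$. Furthermore, assume that $\check\Omega(y)$ is nonnegative definite for every $y\in\mathbb{R}^n$, and that $N^*=\mathrm{span}(X)$. Then the condition $$\mathcal{S}\nsubseteq\mathrm{span}(X)\quad\text{for every }\mathcal{S}\in\mathbb{J}(\mathfrak{M}_0^{lin},\mathfrak{C})$$ is necessary and sufficient for size-controllability (at any significance level $\alpha\in(0,1)$), i.e., is necessary and sufficient for the fact that for every $\alpha\in(0,1)$ there exists a real number $C(\alpha)$ such that $$\sup_{\mu_0\in\mathfrak{M}_0}\ \sup_{0<\sigma^2<\infty}\ \sup_{\Sigma\in\mathfrak{C}}P_{\mu_0,\sigma^2\Sigma}(T\ge C(\alpha))\le\alpha .$$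
   Context: Model: $n,k,q$ are positive integers with $1\le k<n$; $X\in\mathbb{R}^{n\times k}$ is a fixed matrix of rank $k$; $R\in\mathbb{R}^{q\times k}$ has rank $q\ge 1$; $r\in\mathbb{R}^q$. (One tests $R\beta=r$ against $R\beta\ne r$ in $\mathbf{Y}=X\beta+\mathbf{U}$ with $\mathbf{U}\sim N(0,\sigma^2\Sigma)$, $0<\sigma^2<\infty$, $\Sigma\in\mathfrak{C}$.) Here $\mathrm{span}(\cdot)$ is column space, $'$ is transpose, $\mathfrak{M}=\mathrm{span}(X)$, $\mathfrak{M}_0=\{X\beta:\beta\in\mathbb{R}^k,R\beta=r\}$, and $\mathfrak{M}_0^{lin}=\{X\beta:\beta\in\mathbb{R}^k,R\beta=0\}$. $P_{\mu,A}$ is the Gaussian measure on $\mathbb{R}^n$ with mean $\mu$ and covariance matrix $A$; $P(T\ge C)$ means $P(\{y\in\mathbb{R}^n:T(y)\ge C\})$. $\lambda_{\mathbb{R}^n}$ is Lebesgue measure. Covariance model: a nonempty set $\mathfrak{C}$ of symmetric positive definite real $n\times n$ matrices such that $\Sigma\in\mathfrak{C}$ implies $\delta\Sigma\notin\mathfrak{C}$ for every $\delta\ne1$. For a linear subspace $\mathcal{L}$ of $\mathbb{R}^n$ with $\dim\mathcal{L}<n$, let $\Pi_{\mathcal{L}^\perp}$ be the orthogonal projection onto $\mathcal{L}^\perp$, $\mathcal{L}(\Sigma)=\Pi_{\mathcal{L}^\perp}\Sigma\Pi_{\mathcal{L}^\perp}/\|\Pi_{\mathcal{L}^\perp}\Sigma\Pi_{\mathcal{L}^\perp}\|$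 (with $\|\cdot\|$ any norm on $\mathbb{R}^{n\times n}$), $\mathcal{L}(\mathfrak{C})=\{\mathcal{L}(\Sigma):\Sigma\in\mathfrak{C}\}$, and $$\mathbb{J}(\mathcal{L},\mathfrak{C})=\{\mathrm{span}(\bar\Sigma):\bar\Sigma\in\mathrm{cl}(\mathcal{L}(\mathfrak{C})),\ \mathrm{rank}(\bar\Sigma)<n-\dim(\mathcal{L})\},$$ with closure in $\mathbb{R}^{n\times n}$ (the definition does not depend on the norm). Estimator conditions on $(\check\beta,\check\Omega,N)$: (i) $\check\beta:\mathbb{R}^n\setminus N\to\mathbb{R}^k$ and $\check\Omega:\mathbb{R}^n\setminus N\to\mathbb{R}^{q\times q}$ are well-defined and continuous on $\mathbb{R}^n\setminus N$, where $N$ is a closed $\lambda_{\mathbb{R}^n}$-null set, and $\check\Omega(y)$ is symmetric for every $y\in\mathbb{R}^n\setminus N$; (ii) $y\in\mathbb{R}^n\setminus N$ implies $\delta y+X\eta\in\mathbb{R}^n\setminus N$ for all $\delta\ne0$, $\eta\in\mathbb{R}^k$; (iii) $\check\beta(\delta y+X\eta)=\delta\check\beta(y)+\eta$ and $\check\Omega(\delta y+X\eta)=\delta^2\check\Omega(y)$ for all $y\in\mathbb{R}^n\setminus N$, $\delta\neq0$, $\eta\in\mathbb{R}^k$; (iv) $\check\Omega$ is $\lambda_{\mathbb{R}^n}$-almost everywhere nonsingular on $\mathbb{R}^n\setminus N$. Nonsphericity-corrected F-type test statistic: with $N^*=N\cup\{y\in\mathbb{R}^n\setminus N:\det\check\Omega(y)=0\}$,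 $T(y)=(R\check\beta(y)-r)'\check\Omega^{-1}(y)(R\check\beta(y)-r)$ for $y\in\mathbb{R}^n\setminus N^*$ and $T(y)=0$ for $y\in N^*$. *)

theory Defs
  imports "HOL-Analysis.Analysis"
begin

definition sym_mat :: "real^'n^'n \<Rightarrow> bool" where
  "sym_mat A \<longleftrightarrow> transpose A = A"

definition pos_def_mat :: "real^'n^'n \<Rightarrow> bool" where
  "pos_def_mat A \<longleftrightarrow> sym_mat A \<and> (\<forall>x. x \<noteq> 0 \<longrightarrow> x \<bullet> (A *v x) > 0)"

definition nonneg_def_mat :: "real^'n^'n \<Rightarrow> bool" where
  "nonneg_def_mat A \<longleftrightarrow> sym_mat A \<and> (\<forall>x. x \<bullet> (A *v x) \<ge> 0)"

definition col_space :: "real^'k^'n \<Rightarrow> (real^'n) set" where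
  "col_space A = span (columns A)"

definition restr_mean :: "real^'k^'n \<Rightarrow> real^'k^'q \<Rightarrow> real^'q \<Rightarrow> (real^'n) set" where
  "restr_mean X R r = {X *v b | b. R *v b = r}"

definition restr_mean_lin :: "real^'k^'n \<Rightarrow> real^'k^'q \<Rightarrow> (real^'n) set" where
  "restr_mean_lin X R = {X *v b | b. R *v b = 0}"

text \<open>The Gaussian measure with mean \<open>\<mu>\<close> and covariance matrix \<open>A\<close>, by its Lebesgue density.
  This is meaningful for symmetric positive definite \<open>A\<close> only, which is the only case used.\<close>

definition gaussian :: "real^'n \<Rightarrow> real^'n^'n \<Rightarrow> (real^'n) measure" where
  "gaussian \<mu> A = density lborel
     (\<lambda>y. ennreal (exp (- ((y - \<mu>) \<bullet> (matrix_inv A *v (y - \<mu>))) / 2)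
                   / sqrt ((2 * pi) ^ CARD('n) * det A)))"

definition covariance_model :: "(real^'n^'n) set \<Rightarrow> bool" where
  "covariance_model \<CC> \<longleftrightarrow> \<CC> \<noteq> {} \<and>
     (\<forall>\<Sigma>\<in>\<CC>. pos_def_mat \<Sigma> \<and> (\<forall>\<delta>::real. \<delta> \<noteq> 1 \<longrightarrow> \<delta> *\<^sub>R \<Sigma> \<notin> \<CC>))"

text \<open>Matrix of the orthogonal projection onto a linear subspace \<open>V\<close>.\<close>

definition proj_mat :: "(real^'n) set \<Rightarrow> real^'n^'n" where
  "proj_mat V = matrix (\<lambda>x. THE y. y \<in> V \<and> x - y \<in> V\<^sup>\<bottom>)"

text \<open>The norm on matrices is the library (Frobenius) norm; the set \<open>\<JJ>\<close> defined below
  is the same for any other norm.\<close>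

definition scaled_proj :: "(real^'n) set \<Rightarrow> real^'n^'n \<Rightarrow> real^'n^'n" where
  "scaled_proj L \<Sigma> =
     (let P = proj_mat (L\<^sup>\<bottom>) in (P ** \<Sigma> ** P) /\<^sub>R norm (P ** \<Sigma> ** P))"

definition conc_spaces :: "(real^'n) set \<Rightarrow> (real^'n^'n) set \<Rightarrow> (real^'n) set set" (\<open>\<JJ>\<close>) where
  "\<JJ> L \<CC> = {col_space S | S. S \<in> closure (scaled_proj L ` \<CC>) \<and> rank S < CARD('n) - dim L}"

text \<open>Estimators are total functions; their values on \<open>N\<close> are unconstrained and irrelevant.\<close>

definition estimator_conditions ::
  "real^'k^'n \<Rightarrow> (real^'n \<Rightarrow> real^'k) \<Rightarrow> (real^'n \<Rightarrow> real^'q^'q) \<Rightarrow> (real^'n) set \<Rightarrow> bool" where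
  "estimator_conditions X \<beta> \<Omega> N \<longleftrightarrow>
     closed N \<and> N \<in> null_sets lborel \<and>
     continuous_on (- N) \<beta> \<and> continuous_on (- N) \<Omega> \<and> (\<forall>y. y \<notin> N \<longrightarrow> sym_mat (\<Omega> y)) \<and>
     (\<forall>y (\<delta>::real) \<eta>. y \<notin> N \<longrightarrow> \<delta> \<noteq> 0 \<longrightarrow>
        \<delta> *\<^sub>R y + X *v \<eta> \<notin> N \<and>
        \<beta> (\<delta> *\<^sub>R y + X *v \<eta>) = \<delta> *\<^sub>R \<beta> y + \<eta> \<and>
        \<Omega> (\<delta> *\<^sub>R y + X *v \<eta>) = \<delta>\<^sup>2 *\<^sub>R \<Omega> y) \<and>
     (AE y in lborel. y \<notin> N \<longrightarrow> det (\<Omega> y) \<noteq> 0)"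

definition N_star :: "(real^'n \<Rightarrow> real^'q^'q) \<Rightarrow> (real^'n) set \<Rightarrow> (real^'n) set" where
  "N_star \<Omega> N = N \<union> {y. y \<notin> N \<and> det (\<Omega> y) = 0}"

definition F_stat ::
  "real^'k^'q \<Rightarrow> real^'q \<Rightarrow> (real^'n \<Rightarrow> real^'k) \<Rightarrow> (real^'n \<Rightarrow> real^'q^'q) \<Rightarrow> (real^'n) set
    \<Rightarrow> real^'n \<Rightarrow> real" where
  "F_stat R r \<beta> \<Omega> N y =
     (if y \<in> N_star \<Omega> N then 0
      else (R *v \<beta> y - r) \<bullet> (matrix_inv (\<Omega> y) *v (R *v \<beta> y - r)))"

text \<open>Suprema are taken in \<open>ennreal\<close>, a complete lattice, so they carry no side conditions.\<close>

definition test_size ::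
  "(real^'n) set \<Rightarrow> (real^'n^'n) set \<Rightarrow> (real^'n \<Rightarrow> real) \<Rightarrow> real \<Rightarrow> ennreal" where
  "test_size M \<CC> T C =
     (SUP \<mu>\<in>M. SUP \<sigma>2\<in>{0<..}. SUP \<Sigma>\<in>\<CC>. emeasure (gaussian \<mu> (\<sigma>2 *\<^sub>R \<Sigma>)) {y. T y \<ge> C})"

end

theory Submission
  imports Defs "HOL-Probability.Distributions"
begin

text \<open>Let \<open>L = \<MM>\<^sub>0\<^sup>l\<^sup>i\<^sup>n\<close>, let \<open>P\<close> be the projection onto \<open>L\<^sup>\<bottom>\<close>, write \<open>\<Sigma> = A A\<^sup>T\<close> and put
  \<open>B = P A / \<parallel>P \<Sigma> P\<parallel>\<^sup>1\<^sup>/\<^sup>2\<close>. By invariance, the rejection probability under any null distribution with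
  covariance proportional to \<open>\<Sigma>\<close> equals the probability that \<open>T\<^sub>0 (B g) \<ge> C\<close>, where \<open>g\<close> is standard
  Gaussian and \<open>T\<^sub>0\<close> is the statistic for \<open>r = 0\<close>. As \<open>B B\<^sup>T\<close> is the normalised projected covariance,
  the matrices \<open>B\<close> form a bounded set, so along a subsequence they converge to some \<open>B'\<close>, and the
  range of \<open>B'\<close> is the concentration space of the limit. If this range is not contained in \<open>span X\<close>,
  then \<open>B' g\<close> almost surely avoids \<open>span X\<close>, off which \<open>T\<^sub>0\<close> is continuous, so the values
  \<open>T\<^sub>0 (B g)\<close> stay bounded along the subsequence. If it is contained in \<open>span X\<close>, then almost surely
  \<open>B' g = X \<eta>\<close> with \<open>R \<eta> \<noteq> 0\<close>, where the covariance estimator vanishes, so \<open>T\<^sub>0 (B g)\<close> tends to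
  infinity and the size is 1 for every critical value.\<close>

section \<open>Linear algebra\<close>

lemma inner_transpose_mult:
  fixes A :: "real^'m^'n"
  shows "(transpose A *v x) \<bullet> y = x \<bullet> (A *v y)"
  by (simp add: dot_lmul_matrix)

lemma sym_mat_inner_commute:
  assumes "sym_mat W"
  shows "x \<bullet> (W *v y) = y \<bullet> (W *v x)"
proof -
  have "x \<bullet> (W *v y) = (transpose W *v x) \<bullet> y"
    by (rule inner_transpose_mult[symmetric])
  also have "\<dots> = y \<bullet> (W *v x)"
    using assms by (simp add: sym_mat_def inner_commute del: transpose_matrix_vector)
  finally show ?thesis .
qed

lemma matrix_inv_inverse:
  fixes A :: "real^'n^'n"
  assumes "det A \<noteq> 0"
  shows "A ** matrix_inv A = mat 1" "matrix_inv A ** A = mat 1"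
proof -
  have "\<exists>B. A ** B = mat 1 \<and> B ** A = mat 1"
    using assms by (simp add: invertible_det_nz[symmetric] invertible_def)
  then have "A ** matrix_inv A = mat 1 \<and> matrix_inv A ** A = mat 1"
    unfolding matrix_inv_def by (rule someI_ex)
  then show "A ** matrix_inv A = mat 1" "matrix_inv A ** A = mat 1"
    by auto
qed

lemma mult_matrix_inv_vec:
  fixes A :: "real^'n^'n"
  assumes "det A \<noteq> 0"
  shows "A *v (matrix_inv A *v x) = x"
  by (metis assms matrix_inv_inverse(1) matrix_vector_mul_assoc matrix_vector_mul_lid)

lemma matrix_inv_mult_vec:
  fixes A :: "real^'n^'n"
  assumes "det A \<noteq> 0"
  shows "matrix_inv A *v (A *v x) = x"
  by (metis assms matrix_inv_inverse(2) matrix_vector_mul_assoc matrix_vector_mul_lid)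

lemma col_space_eq_range: "col_space A = range ((*v) A)"
proof
  show "col_space A \<subseteq> range ((*v) A)"
    unfolding col_space_def
  proof (rule span_minimal)
    show "columns A \<subseteq> range ((*v) A)"
      by (auto simp: columns_image_basis)
  qed (simp add: linear_subspace_image)
  show "range ((*v) A) \<subseteq> col_space A"
    by (auto simp: col_space_def matrix_vector_mult_in_columnspace)
qed

lemma subspace_col_space: "subspace (col_space A)"
  by (simp add: col_space_def)

text \<open>If \<open>x\<close> is orthogonal to the range of \<open>B ** transpose B\<close>, then
  \<open>transpose B *v x\<close> has squared norm zero, so \<open>x\<close> is orthogonal to the
  range of \<open>B\<close>; double orthogonal complements then give the nontrivial inclusion. This
  identifies the span of a limit covariance with the range of its factor.\<close>

lemma col_space_mult_transpose:
  fixes B :: "real^'m^'n"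
  shows "col_space (B ** transpose B) = col_space B"
proof
  show "col_space (B ** transpose B) \<subseteq> col_space B"
    by (auto simp: col_space_eq_range matrix_vector_mul_assoc[symmetric])
  let ?V = "col_space (B ** transpose B)"
  have "?V\<^sup>\<bottom> \<subseteq> (col_space B)\<^sup>\<bottom>"
  proof
    fix x assume "x \<in> ?V\<^sup>\<bottom>"
    then have "(B *v (transpose B *v x)) \<bullet> x = 0"
      by (auto simp: orthogonal_comp_def orthogonal_def col_space_eq_range matrix_vector_mul_assoc
          simp del: transpose_matrix_vector)
    then have "(transpose B *v x) \<bullet> (transpose B *v x) = 0"
      unfolding inner_transpose_mult by (simp add: inner_commute)
    then have *: "transpose B *v x = 0"
      by (simp del: transpose_matrix_vector)
    have "(B *v y) \<bullet> x = 0" for y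
      using inner_transpose_mult[of B x y] by (simp add: * inner_commute del: transpose_matrix_vector)
    then show "x \<in> (col_space B)\<^sup>\<bottom>"
      by (auto simp: orthogonal_comp_def orthogonal_def col_space_eq_range)
  qed
  then have "(col_space B)\<^sup>\<bottom>\<^sup>\<bottom> \<subseteq> ?V\<^sup>\<bottom>\<^sup>\<bottom>"
    by (rule orthogonal_comp_anti_mono)
  then show "col_space B \<subseteq> ?V"
    by (simp add: orthogonal_comp_self subspace_col_space)
qed

lemma norm_matrix_squared:
  fixes B :: "real^'m^'n"
  shows "(norm B)\<^sup>2 = (\<Sum>i\<in>UNIV. (B ** transpose B) $ i $ i)"
proof -
  have "(norm B)\<^sup>2 = (\<Sum>i\<in>UNIV. B $ i \<bullet> B $ i)"
    unfolding power2_norm_eq_inner inner_vec_def[of B] ..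
  also have "\<dots> = (\<Sum>i\<in>UNIV. (B ** transpose B) $ i $ i)"
    by (simp add: matrix_matrix_mult_def transpose_def inner_vec_def)
  finally show ?thesis .
qed

text \<open>The squared Frobenius norm of \<open>B\<close> is the trace of
  \<open>B ** transpose B\<close>, and each of the \<open>CARD('n)\<close> diagonal entries is at
  most the norm of that matrix. Hence factors of normalised covariances stay bounded.\<close>

lemma norm_matrix_le_mult_transpose:
  fixes B :: "real^'m^'n"
  shows "(norm B)\<^sup>2 \<le> real CARD('n) * norm (B ** transpose B)"
proof -
  have "(B ** transpose B) $ i $ i \<le> norm (B ** transpose B)" for i
    using component_le_norm_cart[of "(B ** transpose B) $ i" i] Finite_Cartesian_Product.norm_nth_le[of "B ** transpose B" i]
    by linarith
  then have "(norm B)\<^sup>2 \<le> (\<Sum>i\<in>(UNIV :: 'n set). norm (B ** transpose B))"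
    unfolding norm_matrix_squared by (intro sum_mono)
  then show ?thesis by simp
qed

section \<open>Orthogonal projection matrices\<close>

text \<open>Existence for the definite description comes from
  \<open>V + V\<^sup>\<bottom> = UNIV\<close>, uniqueness from the trivial intersection. Uniqueness
  also yields linearity, which is what lets \<open>matrix f\<close> act as \<open>f\<close>.\<close>

lemma proj_mat_props:
  fixes V :: "(real^'n) set"
  assumes "subspace V"
  shows "proj_mat V *v x \<in> V" and "x - proj_mat V *v x \<in> V\<^sup>\<bottom>"
proof -
  define f where "f x = (THE y. y \<in> V \<and> x - y \<in> V\<^sup>\<bottom>)" for x :: "real^'n"
  have uniq: "y = z" if "y \<in> V \<and> x - y \<in> V\<^sup>\<bottom>" "z \<in> V \<and> x - z \<in> V\<^sup>\<bottom>" for x y z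
  proof -
    have "y - z \<in> V"
      using that assms subspace_diff by blast
    moreover have "(x - z) - (x - y) \<in> V\<^sup>\<bottom>"
      using that subspace_orthogonal_comp subspace_diff by blast
    ultimately have "y - z \<in> V \<inter> V\<^sup>\<bottom>" by simp
    then show ?thesis using orthogonal_Int_0[OF assms] by simp
  qed
  have ex: "\<exists>y. y \<in> V \<and> x - y \<in> V\<^sup>\<bottom>" for x
  proof -
    have "x \<in> V + V\<^sup>\<bottom>" using subspace_sum_orthogonal_comp[OF assms] by simp
    then obtain y w where "y \<in> V" "w \<in> V\<^sup>\<bottom>" "x = y + w" by (rule set_plus_elim)
    then show ?thesis by (intro exI[of _ y]) simp
  qed
  have f: "f x \<in> V \<and> x - f x \<in> V\<^sup>\<bottom>" for x
    unfolding f_def by (rule theI') (use ex uniq in blast)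
  have "linear f"
  proof (rule linearI)
    fix x y
    have "f x + f y \<in> V" using f assms subspace_add by blast
    moreover have "(x - f x) + (y - f y) \<in> V\<^sup>\<bottom>"
      using f subspace_orthogonal_comp subspace_add by blast
    ultimately show "f (x + y) = f x + f y"
      using uniq[of "f (x + y)" "x + y" "f x + f y"] f by (simp add: algebra_simps)
  next
    fix c :: real and x
    have "c *\<^sub>R f x \<in> V" using f assms subspace_scale by blast
    moreover have "c *\<^sub>R (x - f x) \<in> V\<^sup>\<bottom>"
      using f subspace_orthogonal_comp subspace_scale by blast
    ultimately show "f (c *\<^sub>R x) = c *\<^sub>R f x"
      using uniq[of "f (c *\<^sub>R x)" "c *\<^sub>R x" "c *\<^sub>R f x"] f by (simp add: algebra_simps)
  qed
  moreover have "proj_mat V = matrix f"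
    unfolding proj_mat_def f_def[abs_def] ..
  ultimately have "proj_mat V *v x = f x"
    by (simp add: matrix_works)
  then show "proj_mat V *v x \<in> V" "x - proj_mat V *v x \<in> V\<^sup>\<bottom>"
    using f by auto
qed

text \<open>The form \<open>(P *v x) \<bullet> y\<close> equals
  \<open>(P *v x) \<bullet> (P *v y)\<close>, which is symmetric in \<open>x\<close> and
  \<open>y\<close>.\<close>

lemma transpose_proj_mat:
  assumes "subspace V"
  shows "transpose (proj_mat V) = proj_mat V"
proof -
  let ?P = "proj_mat V"
  have eq: "(?P *v x) \<bullet> y = (?P *v x) \<bullet> (?P *v y)" for x y
  proof -
    have "(?P *v x) \<bullet> (y - ?P *v y) = 0"
      using proj_mat_props[OF assms] by (auto simp: orthogonal_comp_def orthogonal_def)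
    then show ?thesis by (simp add: inner_diff_right)
  qed
  have "(transpose ?P *v x) \<bullet> y = (?P *v x) \<bullet> y" for x y
    unfolding inner_transpose_mult using eq[of x y] eq[of y x] by (metis inner_commute)
  then have "transpose ?P *v x = ?P *v x" for x
    by (rule iffD1[OF vector_eq_rdot, rule_format])
  then show ?thesis
    by (subst matrix_eq) (simp del: transpose_matrix_vector)
qed

text \<open>Gram-Schmidt for the inner product \<open>x' \<Sigma> y\<close>; it replaces the spectral theorem.\<close>

lemma conjugate_orthonormal_columns_exist:
  fixes \<Sigma> :: "real^'n^'n"
  assumes "pos_def_mat \<Sigma>"
  shows "\<exists>C :: real^'n^'n. transpose C ** (\<Sigma> ** C) = mat 1"
proof -
  have sym: "x \<bullet> (\<Sigma> *v y) = y \<bullet> (\<Sigma> *v x)" for x y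
    using assms by (intro sym_mat_inner_commute) (simp add: pos_def_mat_def)
  have "\<exists>c. \<forall>i\<in>I. \<forall>j\<in>I. c i \<bullet> (\<Sigma> *v c j) = (if i = j then 1 else 0)" for I :: "'n set"
    using finite[of I]
  proof (induction rule: finite_induct)
    case empty
    then show ?case by simp
  next
    case (insert i I)
    then obtain c where c: "\<And>j k. j \<in> I \<Longrightarrow> k \<in> I \<Longrightarrow> c j \<bullet> (\<Sigma> *v c k) = (if j = k then 1 else 0)"
      by blast
    \<comment> \<open>Fewer than \<open>CARD('n)\<close> vectors \<open>\<Sigma> *v c j\<close>
      cannot span the space, so some nonzero \<open>x\<close> is orthogonal to all of them. This
      \<open>x\<close> is already conjugate to every \<open>c j\<close>; it only has to be
      rescaled.\<close>
    have "I \<subset> UNIV" using insert by blast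
    then have "card I < CARD('n)" by (simp add: psubset_card_mono)
    moreover have "dim ((\<lambda>j. \<Sigma> *v c j) ` I) \<le> card I"
      by (meson card_image_le dim_le_card' finite finite_imageI order_trans)
    ultimately have "dim ((\<lambda>j. \<Sigma> *v c j) ` I) < DIM(real^'n)" by simp
    then obtain x where x: "x \<noteq> 0" "\<And>y. y \<in> span ((\<lambda>j. \<Sigma> *v c j) ` I) \<Longrightarrow> orthogonal x y"
      by (metis orthogonal_to_subspace_exists)
    have xc: "x \<bullet> (\<Sigma> *v c j) = 0" if "j \<in> I" for j
      using x(2)[OF span_base, of "\<Sigma> *v c j"] that by (simp add: orthogonal_def)
    define s where "s = sqrt (x \<bullet> (\<Sigma> *v x))"
    have pos: "x \<bullet> (\<Sigma> *v x) > 0"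
      using assms x(1) by (simp add: pos_def_mat_def)
    then have s: "s > 0" "s * s = x \<bullet> (\<Sigma> *v x)" by (auto simp: s_def)
    define d where "d = c (i := x /\<^sub>R s)"
    have di: "d i = x /\<^sub>R s" and dI: "d j = c j" if "j \<in> I" for j
      using that insert.hyps(2) by (auto simp: d_def)
    have "d i \<bullet> (\<Sigma> *v d i) = 1"
      using s(1) by (simp add: d_def matrix_vector_mult_scaleR s(2)[symmetric] field_simps)
    moreover have "d i \<bullet> (\<Sigma> *v d j) = 0" "d j \<bullet> (\<Sigma> *v d i) = 0" if "j \<in> I" for j
      using that di dI xc sym[of "c j" x] by (simp_all add: matrix_vector_mult_scaleR)
    moreover have "d j \<bullet> (\<Sigma> *v d k) = (if j = k then 1 else 0)" if "j \<in> I" "k \<in> I" for j k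
      using that by (simp add: dI c)
    ultimately have "\<forall>j\<in>insert i I. \<forall>k\<in>insert i I. d j \<bullet> (\<Sigma> *v d k) = (if j = k then 1 else 0)"
      using insert.hyps(2) by auto
    then show ?case by blast
  qed
  from this[of UNIV] obtain c :: "'n \<Rightarrow> real^'n"
    where c: "\<forall>i j. c i \<bullet> (\<Sigma> *v c j) = (if i = j then 1 else 0)" by auto
  have "(transpose (\<chi> i j. c j $ i) ** (\<Sigma> ** (\<chi> i j. c j $ i))) $ i $ j = c i \<bullet> (\<Sigma> *v c j)" for i j
    by (simp add: matrix_matrix_mult_def transpose_def inner_vec_def matrix_vector_mult_def)
  then show ?thesis
    by (intro exI[of _ "\<chi> i j. c j $ i"]) (simp add: vec_eq_iff mat_def c)
qed

text \<open>From \<open>transpose C ** (\<Sigma> ** C) = mat 1\<close>, the choice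
  \<open>A = \<Sigma> ** C\<close> makes \<open>transpose A\<close> a left inverse of
  \<open>C\<close>, hence also a right inverse, and \<open>A ** transpose A\<close> collapses to
  \<open>\<Sigma>\<close>.\<close>

lemma pos_def_factorization:
  fixes \<Sigma> :: "real^'n^'n"
  assumes "pos_def_mat \<Sigma>"
  obtains A where "\<Sigma> = A ** transpose A" "det A \<noteq> 0"
proof -
  obtain C :: "real^'n^'n" where C: "transpose C ** (\<Sigma> ** C) = mat 1"
    using conjugate_orthonormal_columns_exist[OF assms] by blast
  let ?A = "\<Sigma> ** C"
  have tA: "transpose ?A = transpose C ** \<Sigma>"
    using assms by (simp add: pos_def_mat_def sym_mat_def matrix_transpose_mul)
  have "C ** transpose ?A = mat 1"
    unfolding tA by (rule iffD1[OF matrix_left_right_inverse]) (simp add: C matrix_mul_assoc[symmetric])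
  then have "?A ** transpose ?A = \<Sigma>"
    by (simp add: matrix_mul_assoc[symmetric])
  moreover have "det ?A \<noteq> 0"
    using arg_cong[OF C, of det] by (auto simp: det_mul)
  ultimately show ?thesis
    using that[of ?A] by simp
qed

text \<open>This is the Gaussian exponent in standardised coordinates: cancelling \<open>A\<close>
  shows that \<open>w\<close> solves \<open>transpose A *v w = x\<close>.\<close>

lemma inner_matrix_inv_mult_transpose:
  fixes A :: "real^'n^'n"
  assumes "det A \<noteq> 0"
  shows "(A *v x) \<bullet> (matrix_inv (A ** transpose A) *v (A *v x)) = x \<bullet> x"
proof -
  define w where "w = matrix_inv (A ** transpose A) *v (A *v x)"
  have "det (A ** transpose A) \<noteq> 0"
    using assms by (simp add: det_mul det_transpose)
  then have "(A ** transpose A) *v w = A *v x"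
    unfolding w_def by (rule mult_matrix_inv_vec)
  then have "A *v (transpose A *v w) = A *v x"
    by (simp only: matrix_vector_mul_assoc)
  then have "transpose A *v w = x"
    by (metis assms matrix_inv_mult_vec)
  then have "(A *v x) \<bullet> w = x \<bullet> x"
    by (metis inner_commute inner_transpose_mult)
  then show ?thesis by (simp add: w_def)
qed

text \<open>Gives a lower bound for the test statistic that grows as the covariance estimator
  shrinks, without any appeal to eigenvalues.\<close>

lemma inner_matrix_inv_ge:
  fixes W :: "real^'q^'q"
  assumes "nonneg_def_mat W" "det W \<noteq> 0" "v \<noteq> 0"
  shows "v \<bullet> (matrix_inv W *v v) * (v \<bullet> (W *v v)) \<ge> (v \<bullet> v)\<^sup>2"
proof -
  define w where "w = matrix_inv W *v v"
  have Ww: "W *v w = v" by (simp add: w_def assms mult_matrix_inv_vec)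
  have sym: "x \<bullet> (W *v y) = y \<bullet> (W *v x)" for x y
    using assms(1) by (intro sym_mat_inner_commute) (simp add: nonneg_def_mat_def)
  have psd: "x \<bullet> (W *v x) \<ge> 0" for x
    using assms(1) by (simp add: nonneg_def_mat_def)
  \<comment> \<open>Cauchy-Schwarz for the form \<open>W\<close> and the vectors \<open>v\<close> and \<open>W\<inverse> v\<close>\<close>
  define a b c where "a = v \<bullet> (W *v v)" and "b = v \<bullet> v" and "c = v \<bullet> w"
  have q: "a * s\<^sup>2 - 2 * s * t * b + t\<^sup>2 * c \<ge> 0" for s t
  proof -
    have "(s *\<^sub>R v - t *\<^sub>R w) \<bullet> (W *v (s *\<^sub>R v - t *\<^sub>R w)) =
      s\<^sup>2 * a - s * t * (v \<bullet> (W *v w)) - s * t * (w \<bullet> (W *v v)) + t\<^sup>2 * (w \<bullet> (W *v w))"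
      unfolding a_def
      by (simp add: matrix_vector_mult_diff_distrib matrix_vector_mult_scaleR inner_diff_left
          inner_diff_right algebra_simps power2_eq_square)
    also have "\<dots> = a * s\<^sup>2 - 2 * s * t * b + t\<^sup>2 * c"
      by (simp add: sym[of w v] Ww b_def c_def inner_commute[of w v] algebra_simps)
    finally show ?thesis using psd by metis
  qed
  \<comment> \<open>The choice \<open>s = b\<close>, \<open>t = a\<close> nearly minimises nothing
    by itself but makes the form factor as \<open>a * (a * c - b\<^sup>2)\<close>, so only
    \<open>a > 0\<close> remains to be shown.\<close>
  have "a * b\<^sup>2 - 2 * b * a * b + a\<^sup>2 * c \<ge> 0"
    using q[of b a] .
  then have "a * (a * c - b\<^sup>2) \<ge> 0"
    by (simp add: power2_eq_square algebra_simps)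
  moreover have "a \<ge> 0" using psd by (simp add: a_def)
  moreover have "b > 0" using assms(3) by (simp add: b_def)
  moreover have "a \<noteq> 0"
  proof
    \<comment> \<open>With \<open>a = 0\<close> and \<open>t = 1\<close> the form is affine in
      \<open>s\<close> with slope \<open>- 2 * b\<close>; the point chosen below gives it the value
      \<open>- 1\<close>.\<close>
    assume "a = 0"
    then have "- 2 * s * b + c \<ge> 0" for s using q[of s 1] by simp
    from this[of "(c + 1) / (2 * b)"] \<open>b > 0\<close> show False by (simp add: field_simps)
  qed
  ultimately have "a * c - b\<^sup>2 \<ge> 0"
    by (simp add: zero_le_mult_iff)
  then show ?thesis by (simp add: a_def b_def c_def w_def mult.commute)
qed

section \<open>Gaussian measures\<close>

text \<open>The library's \<open>measure_linear_image\<close> requires a well-ordered index type; the order only serves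
  to compute the determinant of a shear, which is a row operation.\<close>

lemma measure_linear_image_finite_aux:
  fixes f :: "real^'n \<Rightarrow> real^'n"
  assumes "linear f"
  shows "\<forall>S \<in> lmeasurable. f ` S \<in> lmeasurable \<and>
    \<bar>det (matrix f)\<bar> * measure lebesgue S = measure lebesgue (f ` S)" (is "?P f")
  using assms
proof (rule induct_linear_elementary)
  fix f g :: "real^'n \<Rightarrow> real^'n"
  assume lin: "linear f" "linear g" and P: "?P f" "?P g"
  show "?P (f \<circ> g)"
  proof
    fix S :: "(real^'n) set" assume "S \<in> lmeasurable"
    with P have "g ` S \<in> lmeasurable" "\<bar>det (matrix g)\<bar> * measure lebesgue S = measure lebesgue (g ` S)"
      by blast+
    moreover from this P have "f ` g ` S \<in> lmeasurable"
      "\<bar>det (matrix f)\<bar> * measure lebesgue (g ` S) = measure lebesgue (f ` g ` S)"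
      by blast+
    ultimately show "(f \<circ> g) ` S \<in> lmeasurable \<and>
        \<bar>det (matrix (f \<circ> g))\<bar> * measure lebesgue S = measure lebesgue ((f \<circ> g) ` S)"
      by (simp add: matrix_compose[OF lin(2,1)] det_mul abs_mult image_image mult.assoc)
  qed
next
  fix f :: "real^'n \<Rightarrow> real^'n" and i
  assume lin: "linear f" and 0: "\<And>x. f x $ i = 0"
  \<comment> \<open>A map whose \<open>i\<close>-th coordinate vanishes misses this unit vector, so
    it is singular: its images are negligible and its determinant is zero.\<close>
  have "axis i 1 \<notin> range f"
    using 0 by (metis axis_nth rangeE zero_neq_one)
  then have ninj: "\<not> inj f"
    using linear_injective_imp_surjective[OF lin] by auto
  have "negligible (f ` S)" for S
    using negligible_linear_singular_image[OF lin ninj] .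
  moreover have "det (matrix f) = 0"
    using det_nz_iff_inj[OF lin] ninj by blast
  ultimately show "?P f"
    by (simp add: negligible_imp_measurable negligible_imp_measure0)
next
  fix c :: "'n \<Rightarrow> real"
  have "det (matrix (\<lambda>x::real^'n. \<chi> i. c i * x $ i)) = prod c UNIV"
    by (subst det_diagonal) (auto simp: matrix_def axis_def)
  then show "?P (\<lambda>x. \<chi> i. c i * x $ i)"
    by (simp add: measurable_stretch measure_stretch)
next
  fix m n :: 'n
  assume "m \<noteq> n"
  let ?\<pi> = "Transposition.transpose m n"
  let ?h = "\<lambda>x::real^'n. \<chi> i. x $ ?\<pi> i"
  have lin: "linear ?h"
    by (rule linearI) (simp_all add: vec_eq_iff)
  have box: "measure lebesgue (?h ` cbox a b) = measure lebesgue (cbox a b)" for a b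
  proof -
    have inv: "?h (?h x) = x" for x by (simp add: vec_eq_iff)
    have all: "(\<forall>i. Q (?\<pi> i)) \<longleftrightarrow> (\<forall>i. Q i)" for Q
      by (metis transpose_involutory)
    have mem: "?h x \<in> cbox (?h a) (?h b) \<longleftrightarrow> x \<in> cbox a b" for x a b
      using all[of "\<lambda>i. a $ i \<le> x $ i \<and> x $ i \<le> b $ i"] by (simp add: mem_box_cart)
    have im: "?h ` cbox a b = cbox (?h a) (?h b)"
    proof (intro set_eqI iffI)
      fix y assume "y \<in> cbox (?h a) (?h b)"
      then show "y \<in> ?h ` cbox a b"
        using mem[of "?h y" a b] unfolding inv by (intro image_eqI[of _ _ "?h y"]) (simp_all only: inv)
    qed (use mem in blast)
    have "(\<Prod>i\<in>UNIV. (b - a) $ ?\<pi> i) = (\<Prod>i\<in>UNIV. (b - a) $ i)"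
      by (rule prod.reindex_bij_betw) simp
    moreover have "cbox (?h a) (?h b) = {} \<longleftrightarrow> cbox a b = {}"
      unfolding im[symmetric] by (rule image_is_empty)
    ultimately show ?thesis
      unfolding im by (simp add: content_cbox_if_cart)
  qed
  have det: "\<bar>det (matrix ?h)\<bar> = 1"
  proof -
    have "matrix ?h = (\<chi> i. mat 1 $ ?\<pi> i)"
      by (simp add: matrix_def vec_eq_iff mat_def axis_def)
    then show ?thesis
      by (simp add: det_permute_rows permutes_swap_id sign_swap_id abs_mult)
  qed
  show "?P ?h"
  proof
    show "?h ` S \<in> lmeasurable \<and> \<bar>det (matrix ?h)\<bar> * measure lebesgue S = measure lebesgue (?h ` S)"
      if "S \<in> lmeasurable" for S
      by (rule measure_linear_sufficient[OF lin that]) (simp only: box det abs_one mult_1)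
  qed
next
  fix m n :: 'n
  assume mn: "m \<noteq> n"
  let ?h = "\<lambda>x::real^'n. \<chi> i. if i = m then x $ m + x $ n else x $ i"
  have lin: "linear ?h"
    by (rule linearI) (auto simp: vec_eq_iff algebra_simps)
  have box: "measure lebesgue (?h ` cbox a b) = measure lebesgue (cbox a b)" for a b
  proof (cases "cbox a b = {}")
    case False
    \<comment> \<open>Translating by \<open>\<bar>a $ n\<bar>\<close> in every coordinate makes the
      \<open>n\<close>-th coordinate of the lower corner nonnegative, as
      \<open>measure_shear_interval\<close> requires. Linearity turns this into a translation of the
      image.\<close>
    define w :: "real^'n" where "w = (\<chi> i. \<bar>a $ n\<bar>)"
    have ab: "cbox a b = (+) (- w) ` cbox (w + a) (w + b)"
      by (simp add: cbox_translation[of w] image_image)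
    have "?h ((- w) + x) = - ?h w + ?h x" for x
      by (simp add: vec_eq_iff)
    then have "?h ` cbox a b = (+) (- ?h w) ` ?h ` cbox (w + a) (w + b)"
      unfolding ab image_image by simp
    then have "measure lebesgue (?h ` cbox a b) = measure lebesgue (?h ` cbox (w + a) (w + b))"
      by (simp only: measure_translation)
    also have "\<dots> = measure lebesgue (cbox (w + a) (w + b))"
      by (rule measure_shear_interval[OF mn]) (use False in \<open>auto simp: cbox_translation w_def\<close>)
    also have "\<dots> = measure lebesgue (cbox a b)"
      unfolding ab by (simp only: measure_translation)
    finally show ?thesis .
  qed simp
  have det: "det (matrix ?h) = 1"
  proof -
    have "matrix ?h = (\<chi> i. if i = m then row m (mat 1) + 1 *s row n (mat 1) else row i (mat 1))"
      by (auto simp: matrix_def vec_eq_iff mat_def axis_def row_def)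
    then show ?thesis
      using det_row_operation[OF mn, where c=1 and A="mat 1 :: real^'n^'n"] by simp
  qed
  show "?P ?h"
  proof
    show "?h ` S \<in> lmeasurable \<and> \<bar>det (matrix ?h)\<bar> * measure lebesgue S = measure lebesgue (?h ` S)"
      if "S \<in> lmeasurable" for S
      by (rule measure_linear_sufficient[OF lin that]) (simp only: box det abs_one mult_1)
  qed
qed

lemma measure_linear_image_finite:
  fixes f :: "real^'n \<Rightarrow> real^'n"
  assumes "linear f" "S \<in> lmeasurable"
  shows "f ` S \<in> lmeasurable" "measure lebesgue (f ` S) = \<bar>det (matrix f)\<bar> * measure lebesgue S"
  using measure_linear_image_finite_aux[OF assms(1)] assms(2) by metis+

section \<open>Affine change of variables for Lebesgue measure\<close>

lemma continuous_on_matrix_mult_vec [continuous_intros]: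
  fixes A :: "real^'m^'n"
  assumes "continuous_on S f"
  shows "continuous_on S (\<lambda>x. A *v f x)"
  using continuous_on_compose2[OF linear_continuous_on_compose[of UNIV "\<lambda>x. x" "(*v) A"] assms] by simp

lemma measurable_matrix_affine [measurable]:
  fixes A :: "real^'m^'n"
  shows "(\<lambda>x. \<mu> + A *v x) \<in> borel_measurable borel"
  by (intro borel_measurable_continuous_onI continuous_intros)

text \<open>It is enough to compare the measures on boxes. The preimage of a box is the image of a
  translated box under the inverse matrix, and its factor
  \<open>\<bar>det (matrix_inv A)\<bar>\<close> cancels against the constant density.\<close>

lemma lborel_matrix_affine:
  fixes A :: "real^'n^'n"
  assumes "det A \<noteq> 0"
  shows "lborel = density (distr lborel borel (\<lambda>x. \<mu> + A *v x)) (\<lambda>_. ennreal \<bar>det A\<bar>)"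
proof (rule lborel_eqI)
  fix l u :: "real^'n"
  assume lu: "\<And>b. b \<in> Basis \<Longrightarrow> l \<bullet> b \<le> u \<bullet> b"
  let ?B = "matrix_inv A"
  have det: "\<bar>det A\<bar> * \<bar>det ?B\<bar> = 1"
    using arg_cong[OF matrix_inv_inverse(1)[OF assms], of det] by (simp add: det_mul abs_mult[symmetric])
  let ?T = "\<lambda>x. \<mu> + A *v x" and ?S = "(\<lambda>x. \<mu> + A *v x) -` box l u"
  have S: "?S = (*v) ?B ` box (l - \<mu>) (u - \<mu>)"
  proof (intro set_eqI iffI)
    fix x assume "x \<in> ?S"
    then show "x \<in> (*v) ?B ` box (l - \<mu>) (u - \<mu>)"
      by (intro image_eqI[of _ _ "A *v x"])
        (auto simp: matrix_inv_mult_vec[OF assms] box_def inner_diff_left inner_add_left algebra_simps)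
  qed (auto simp: mult_matrix_inv_vec[OF assms] box_def inner_diff_left inner_add_left algebra_simps)
  have bS: "?S \<in> sets borel"
    using measurable_sets[OF measurable_matrix_affine[of \<mu> A], of "box l u"] by simp
  have "?S \<in> lmeasurable"
    unfolding S by (intro measure_linear_image_finite(1) lmeasurable_box) simp
  then have "emeasure lborel ?S = ennreal (measure lebesgue ?S)"
    using bS by (subst emeasure_eq_measure2[symmetric]) simp_all
  also have "measure lebesgue ?S = \<bar>det ?B\<bar> * measure lebesgue (box (l - \<mu>) (u - \<mu>))"
    unfolding S by (subst measure_linear_image_finite(2)) simp_all
  also have "measure lebesgue (box (l - \<mu>) (u - \<mu>)) = (\<Prod>b\<in>Basis. (u - l) \<bullet> b)"
    using lu by (simp add: measure_lborel_box inner_diff_left)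
  finally have "emeasure lborel ?S = ennreal (\<bar>det ?B\<bar> * (\<Prod>b\<in>Basis. (u - l) \<bullet> b))" .
  then show "emeasure (density (distr lborel borel ?T) (\<lambda>_. ennreal \<bar>det A\<bar>)) (box l u)
      = ennreal (\<Prod>b\<in>Basis. (u - l) \<bullet> b)"
    by (simp add: emeasure_density_const emeasure_distr ennreal_mult'[symmetric] mult.assoc[symmetric] det)
qed simp

section \<open>Gaussian measures as images of the standard one\<close>

lemma matrix_inv_mat_1: "matrix_inv (mat 1 :: real^'n^'n) = mat 1"
  using matrix_inv_inverse(1)[of "mat 1 :: real^'n^'n"] by simp

lemma gaussian_standard:
  "gaussian 0 (mat 1 :: real^'n^'n) =
    density lborel (\<lambda>x. ennreal (exp (- (x \<bullet> x) / 2) / sqrt ((2 * pi) ^ CARD('n))))"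
  by (simp add: gaussian_def matrix_inv_mat_1)

text \<open>In the change of variables, \<open>\<bar>det A\<bar>\<close> cancels against the root of
  \<open>det (A ** transpose A)\<close>. Realising all covariances on one standard Gaussian space
  allows almost sure limits along a sequence of covariances.\<close>

lemma gaussian_eq_distr:
  fixes A :: "real^'n^'n"
  assumes "det A \<noteq> 0"
  shows "gaussian \<mu> (A ** transpose A) = distr (gaussian 0 (mat 1)) borel (\<lambda>x. \<mu> + A *v x)"
proof -
  let ?T = "\<lambda>x. \<mu> + A *v x"
  define f where "f y = ennreal (exp (- ((y - \<mu>) \<bullet> (matrix_inv (A ** transpose A) *v (y - \<mu>))) / 2)
      / sqrt ((2 * pi) ^ CARD('n) * det (A ** transpose A)))" for y
  have [measurable]: "f \<in> borel_measurable borel"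
    unfolding f_def
    by (intro measurable_compose[OF _ measurable_ennreal] borel_measurable_continuous_onI continuous_intros)
      (use assms in \<open>auto simp: det_mul det_transpose\<close>)
  have "sqrt ((2 * pi) ^ CARD('n) * det (A ** transpose A)) = sqrt ((2 * pi) ^ CARD('n)) * \<bar>det A\<bar>"
    by (simp add: det_mul det_transpose real_sqrt_mult)
  then have f: "ennreal \<bar>det A\<bar> * f (?T x) = ennreal (exp (- (x \<bullet> x) / 2) / sqrt ((2 * pi) ^ CARD('n)))" for x
    using assms by (simp add: f_def inner_matrix_inv_mult_transpose ennreal_mult'[symmetric])
  have "gaussian \<mu> (A ** transpose A) = density lborel f"
    unfolding gaussian_def f_def ..
  also have "\<dots> = density (density (distr lborel borel ?T) (\<lambda>_. ennreal \<bar>det A\<bar>)) f"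
    by (simp add: lborel_matrix_affine[OF assms, of \<mu>, symmetric])
  also have "\<dots> = density (distr lborel borel ?T) (\<lambda>y. ennreal \<bar>det A\<bar> * f y)"
    by (subst density_density_eq) simp_all
  also have "\<dots> = distr (density lborel (\<lambda>x. ennreal \<bar>det A\<bar> * f (?T x))) borel ?T"
    by (subst density_distr) simp_all
  also have "\<dots> = distr (gaussian 0 (mat 1)) borel ?T"
    by (simp add: f gaussian_standard)
  finally show ?thesis .
qed

text \<open>The density is a product of one-dimensional standard normal densities over the basis, so
  the integral factors into integrals equal to 1.\<close>

lemma prob_space_standard_gaussian: "prob_space (gaussian 0 (mat 1 :: real^'n^'n))"
proof
  have eq: "ennreal (exp (- (x \<bullet> x) / 2) / sqrt ((2 * pi) ^ CARD('n)))
      = (\<Prod>b\<in>Basis. ennreal (std_normal_density (x \<bullet> b)))" for x :: "real^'n"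
  proof -
    have "(\<Prod>b\<in>Basis. std_normal_density (x \<bullet> b))
        = (1 / sqrt (2 * pi)) ^ CARD('n) * exp (\<Sum>b\<in>Basis. - (x \<bullet> b)\<^sup>2 / 2)"
      by (simp only: std_normal_density_def prod.distrib prod_constant exp_sum[OF finite_Basis])
        (simp add: power_divide)
    also have "(\<Sum>b\<in>Basis. - (x \<bullet> b)\<^sup>2 / 2) = - (x \<bullet> x) / 2"
      unfolding euclidean_inner[of x x]
      by (simp only: sum_divide_distrib[symmetric] sum_negf power2_eq_square)
    finally show ?thesis
      by (simp add: prod_ennreal power_divide real_sqrt_power real_sqrt_mult power_mult_distrib)
  qed
  have "emeasure (gaussian 0 (mat 1 :: real^'n^'n)) (space (gaussian 0 (mat 1)))
      = (\<integral>\<^sup>+x. (\<Prod>b\<in>(Basis :: (real^'n) set). ennreal (std_normal_density (x \<bullet> b))) \<partial>lborel)"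
    unfolding gaussian_standard eq by (simp add: emeasure_density)
  also have "\<dots> = 1"
    using nn_integral_lborel_prod[where f = "\<lambda>(b::real^'n) x. ennreal (std_normal_density x)"]
      prob_space.emeasure_space_1[OF prob_space_normal_density[of 1 0]]
    by (simp add: emeasure_density)
  finally show "emeasure (gaussian 0 (mat 1 :: real^'n^'n)) (space (gaussian 0 (mat 1))) = 1" .
qed

lemma sets_gaussian [measurable_cong, simp]: "sets (gaussian \<mu> A) = sets borel"
  by (simp add: gaussian_def)

lemma space_gaussian [simp]: "space (gaussian \<mu> A) = UNIV"
  by (simp add: gaussian_def)

text \<open>The preimage of \<open>V\<close> under \<open>B\<close> is a proper subspace, hence of
  lower dimension and Lebesgue null.\<close>

lemma AE_standard_gaussian_notin_subspace:
  fixes B :: "real^'n^'m"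
  assumes "subspace V" "\<not> col_space B \<subseteq> V"
  shows "AE x in gaussian 0 (mat 1 :: real^'n^'n). B *v x \<notin> V"
proof -
  let ?S = "{x. B *v x \<in> V}"
  have sub: "subspace ?S"
    using linear_subspace_vimage[OF matrix_vector_mul_linear[of B] assms(1)] by (simp add: vimage_def)
  moreover have "?S \<noteq> UNIV"
    using assms(2) by (auto simp: col_space_eq_range)
  ultimately have "dim ?S < DIM(real^'n)"
    by (metis dim_eq_full dim_subset_UNIV le_neq_implies_less span_eq_iff)
  then have "negligible ?S" by (rule negligible_lowdim)
  then have "?S \<in> null_sets lborel"
    using closed_subspace[OF sub] by (simp add: negligible_iff_null_sets null_sets_completion_iff)
  then have "AE x in lborel. B *v x \<notin> V"
    by (rule AE_I') simp
  then show ?thesis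
    unfolding gaussian_standard by (subst AE_density) auto
qed

section \<open>Limits of matrices and of events\<close>

lemma tendsto_matrix_vector_mult [tendsto_intros]:
  fixes A :: "'b \<Rightarrow> real^'m^'n"
  assumes "(A \<longlongrightarrow> a) F" "(x \<longlongrightarrow> b) F"
  shows "((\<lambda>k. A k *v x k) \<longlongrightarrow> a *v b) F"
  unfolding matrix_vector_mult_def using assms by (auto intro!: tendsto_intros)

lemma tendsto_mult_transpose:
  fixes B :: "'b \<Rightarrow> real^'m^'n"
  assumes "(B \<longlongrightarrow> b) F"
  shows "((\<lambda>k. B k ** transpose (B k)) \<longlongrightarrow> b ** transpose b) F"
  unfolding matrix_matrix_mult_def transpose_def using assms by (auto intro!: tendsto_intros)

lemma continuous_on_det:
  fixes A :: "'a::topological_space \<Rightarrow> real^'n^'n"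
  assumes "\<And>i j. continuous_on S (\<lambda>x. A x $ i $ j)"
  shows "continuous_on S (\<lambda>x. det (A x))"
  unfolding det_def
  by (intro continuous_on_sum continuous_on_mult continuous_on_const continuous_on_prod assms)

text \<open>By Cramer's rule each coordinate is a quotient of determinants whose entries vary
  continuously.\<close>

lemma continuous_on_matrix_inv_vec:
  fixes W :: "'a::topological_space \<Rightarrow> real^'n^'n"
  assumes "continuous_on S W" "continuous_on S v" "\<And>x. x \<in> S \<Longrightarrow> det (W x) \<noteq> 0"
  shows "continuous_on S (\<lambda>x. matrix_inv (W x) *v v x)"
proof -
  have c: "continuous_on S (\<lambda>x. W x $ i $ j)" "continuous_on S (\<lambda>x. v x $ i)" for i j
    using assms(1,2) by (auto intro!: continuous_intros)
  then have c': "continuous_on S (\<lambda>x. if j = k then v x $ i else W x $ i $ j)" for i j k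
    by (cases "j = k") simp_all
  have "continuous_on S (\<lambda>x. (\<chi> k. det (\<chi> i j. if j = k then v x $ i else W x $ i $ j) / det (W x)) :: real^'n)"
    by (intro continuous_on_vec_lambda continuous_on_divide continuous_on_det)
      (use assms(3) c c' in auto)
  moreover have "(\<chi> k. det (\<chi> i j. if j = k then v x $ i else W x $ i $ j) / det (W x))
      = matrix_inv (W x) *v v x" if "x \<in> S" for x
    by (rule iffD1[OF cramer mult_matrix_inv_vec, symmetric]) (simp_all add: assms(3) that)
  ultimately show ?thesis
    by (rule continuous_on_eq)
qed

text \<open>Dominated convergence for the indicators of the events, with the constant 1 as
  majorant.\<close>

lemma (in prob_space) prob_tendsto_0_if_AE_eventually_notin:
  assumes "\<And>m. E m \<in> events" "AE x in M. eventually (\<lambda>m. x \<notin> E m) sequentially"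
  shows "(\<lambda>m. prob (E m)) \<longlonglongrightarrow> 0"
proof -
  have "(\<lambda>m. \<integral>x. indicator (E m) x \<partial>M) \<longlonglongrightarrow> (\<integral>x. (0::real) \<partial>M)"
  proof (rule integral_dominated_convergence[where w = "\<lambda>_. 1"])
    show "AE x in M. (\<lambda>m. indicator (E m) x) \<longlonglongrightarrow> (0::real)"
      using assms(2) by eventually_elim (rule tendsto_eventually, erule eventually_mono, simp)
  qed (use assms(1) in \<open>auto simp: indicator_def\<close>)
  then show ?thesis using assms(1) by simp
qed

section \<open>The test statistic\<close>

text \<open>The vector \<open>r\<close> is not a parameter, because the statistic for general
  \<open>r\<close> is compared with the one for \<open>r = 0\<close>.\<close>

locale F_type_test =
  fixes X :: "real^'k^'n" and R :: "real^'k^'q"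
    and \<beta> :: "real^'n \<Rightarrow> real^'k" and \<Omega> :: "real^'n \<Rightarrow> real^'q^'q"
  assumes card_less: "CARD('k) < CARD('n)"
    and rank_R: "rank R = CARD('q)"
    and est: "estimator_conditions X \<beta> \<Omega> {}"
    and nonneg: "nonneg_def_mat (\<Omega> y)"
    and N_star_eq: "N_star \<Omega> {} = col_space X"
begin

abbreviation "T r \<equiv> F_stat R r \<beta> \<Omega> {}"
abbreviation "L \<equiv> restr_mean_lin X R"
abbreviation "P \<equiv> proj_mat (L\<^sup>\<bottom>)"
abbreviation "\<gamma> \<equiv> gaussian 0 (mat 1 :: real^'n^'n)"

lemma est_simps:
  assumes "\<delta> \<noteq> 0"
  shows "\<beta> (\<delta> *\<^sub>R y + X *v \<eta>) = \<delta> *\<^sub>R \<beta> y + \<eta>" "\<Omega> (\<delta> *\<^sub>R y + X *v \<eta>) = \<delta>\<^sup>2 *\<^sub>R \<Omega> y"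
  using est assms unfolding estimator_conditions_def by auto

lemma continuous_est: "continuous_on UNIV \<beta>" "continuous_on UNIV \<Omega>"
  using est by (auto simp: estimator_conditions_def)

text \<open>Equivariance at the origin with factor 2 gives
  \<open>\<beta> 0 = 2 *\<^sub>R \<beta> 0\<close> and
  \<open>\<Omega> 0 = 4 *\<^sub>R \<Omega> 0\<close>, so both vanish; a shift by
  \<open>X *v \<eta>\<close> does the rest. That \<open>\<Omega>\<close> is zero on the column space
  of \<open>X\<close> drives the necessity direction.\<close>

lemma \<beta>_X: "\<beta> (X *v \<eta>) = \<eta>" and \<Omega>_X: "\<Omega> (X *v \<eta>) = 0"
proof -
  have "\<beta> 0 = 2 *\<^sub>R \<beta> 0" "\<Omega> 0 = 2\<^sup>2 *\<^sub>R \<Omega> 0"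
    using est_simps[of 2 0 0] by simp_all
  then have "\<beta> 0 = 0" "\<Omega> 0 = 0"
    using scaleR_cancel_right[of 4 "\<Omega> 0" 1] by (simp_all add: scaleR_2)
  then show "\<beta> (X *v \<eta>) = \<eta>" "\<Omega> (X *v \<eta>) = 0"
    using est_simps[of 1 0 \<eta>] by simp_all
qed

lemma det_\<Omega>_eq_0_iff: "det (\<Omega> y) = 0 \<longleftrightarrow> y \<in> col_space X"
  using N_star_eq by (auto simp: N_star_def)

lemma F_stat_eq:
  "T r y = (if y \<in> col_space X then 0 else (R *v \<beta> y - r) \<bullet> (matrix_inv (\<Omega> y) *v (R *v \<beta> y - r)))"
  by (simp add: F_stat_def N_star_eq)

text \<open>The vector \<open>R *v \<beta> y - r\<close> scales by \<open>\<delta>\<close> and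
  \<open>\<Omega>\<close> by its square, so the quadratic form is unchanged. Thus neither the scale
  nor a shift within \<open>L\<close> matters, and the null hypothesis reduces to
  \<open>r = 0\<close>.\<close>

lemma F_stat_invariant:
  assumes "R *v b = r" "R *v \<eta> = 0" "\<delta> \<noteq> 0"
  shows "T r (\<delta> *\<^sub>R z + X *v (b + \<eta>)) = T 0 z"
proof -
  let ?y = "\<delta> *\<^sub>R z + X *v (b + \<eta>)"
  \<comment> \<open>Both points lie in the column space of \<open>X\<close> or neither does, so the
    default value 0 is used on both sides or on neither.\<close>
  have det: "det (\<Omega> ?y) = 0 \<longleftrightarrow> det (\<Omega> z) = 0"
  proof -
    have X: "X *v b' \<in> col_space X" for b'
      by (simp add: col_space_eq_range)
    have z: "inverse \<delta> *\<^sub>R ?y - X *v (inverse \<delta> *\<^sub>R (b + \<eta>)) = z"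
      using assms(3) by (simp add: matrix_vector_mult_scaleR scaleR_right_distrib matrix_vector_right_distrib)
    have "inverse \<delta> *\<^sub>R ?y - X *v (inverse \<delta> *\<^sub>R (b + \<eta>)) \<in> col_space X" if "?y \<in> col_space X"
      using that X
      by (intro subspace_diff[OF subspace_col_space] subspace_scale[OF subspace_col_space])
    then have "?y \<in> col_space X \<Longrightarrow> z \<in> col_space X"
      unfolding z .
    moreover have "?y \<in> col_space X" if "z \<in> col_space X"
      using that X by (intro subspace_add[OF subspace_col_space] subspace_scale[OF subspace_col_space])
    ultimately show ?thesis unfolding det_\<Omega>_eq_0_iff by blast
  qed
  have v: "R *v \<beta> ?y - r = \<delta> *\<^sub>R (R *v \<beta> z)"
    unfolding est_simps(1)[OF assms(3)] using assms(1,2)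
    by (simp add: matrix_vector_right_distrib matrix_vector_mult_scaleR)
  have "(\<delta> *\<^sub>R v) \<bullet> (matrix_inv (\<delta>\<^sup>2 *\<^sub>R W) *v (\<delta> *\<^sub>R v)) = v \<bullet> (matrix_inv W *v v)"
    if "det W \<noteq> 0" "det (\<delta>\<^sup>2 *\<^sub>R W) \<noteq> 0" for W :: "real^'q^'q" and v
  proof -
    define u where "u = matrix_inv (\<delta>\<^sup>2 *\<^sub>R W) *v (\<delta> *\<^sub>R v)"
    have "\<delta>\<^sup>2 *\<^sub>R (W *v u) = \<delta> *\<^sub>R v"
      unfolding u_def scaleR_matrix_vector_assoc by (rule mult_matrix_inv_vec[OF that(2)])
    then have "\<delta> *\<^sub>R (W *v (\<delta> *\<^sub>R u)) = \<delta> *\<^sub>R v"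
      by (simp add: matrix_vector_mult_scaleR power2_eq_square)
    then have "W *v (\<delta> *\<^sub>R u) = v"
      using assms(3) by (simp only: scaleR_cancel_left) simp
    then have "\<delta> *\<^sub>R u = matrix_inv W *v v"
      using matrix_inv_mult_vec[OF that(1)] by metis
    then have "(\<delta> *\<^sub>R v) \<bullet> u = v \<bullet> (matrix_inv W *v v)"
      by (simp flip: \<open>\<delta> *\<^sub>R u = matrix_inv W *v v\<close>)
    then show ?thesis by (simp only: u_def)
  qed
  from this[of "\<Omega> z" "R *v \<beta> z"] show ?thesis
    unfolding F_stat_eq v det_\<Omega>_eq_0_iff[symmetric] using det est_simps(2)[OF assms(3)] by simp
qed

lemma continuous_on_T0: "continuous_on (- col_space X) (T 0)"
proof -
  have "continuous_on (- col_space X) (\<lambda>y. (R *v \<beta> y) \<bullet> (matrix_inv (\<Omega> y) *v (R *v \<beta> y)))"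
    using continuous_est[THEN continuous_on_subset, of "- col_space X"]
    by (intro continuous_on_inner continuous_on_matrix_inv_vec continuous_on_matrix_mult_vec)
      (auto simp: det_\<Omega>_eq_0_iff)
  then show ?thesis
    by (rule continuous_on_eq) (simp add: F_stat_eq)
qed

text \<open>The statistic is 0 on the closed set \<open>col_space X\<close>, so multiplying by the
  indicator of the complement, where it is continuous, does not change it.\<close>

lemma measurable_T0 [measurable]: "T 0 \<in> borel_measurable borel"
proof -
  have "(\<lambda>y. indicator (- col_space X) y *\<^sub>R T 0 y) \<in> borel_measurable borel"
    by (intro borel_measurable_continuous_on_indicator continuous_on_T0)
      (simp add: borel_open closed_subspace subspace_col_space)
  also have "(\<lambda>y. indicator (- col_space X) y *\<^sub>R T 0 y) = T 0"
    by (auto simp: fun_eq_iff F_stat_eq indicator_def)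
  finally show ?thesis .
qed

lemma measurable_T: "T r \<in> borel_measurable borel"
proof -
  obtain b where b: "R *v b = r"
    using rank_R by (metis full_rank_surjective surjD)
  have "T r y = T 0 (y - X *v b)" for y
    using F_stat_invariant[OF b, of 0 1 "y - X *v b"] by simp
  then have "T r = (\<lambda>y. T 0 (y - X *v b))"
    by (rule ext)
  then show ?thesis by simp
qed

section \<open>The subspace \<open>L\<close> and the reduction to standard Gaussian events\<close>

lemma subspace_L: "subspace L"
proof -
  have "L = (*v) X ` {b. R *v b = 0}"
    by (auto simp: restr_mean_lin_def)
  moreover have "subspace {b. R *v b = 0}"
    by (auto simp: subspace_def matrix_vector_right_distrib matrix_vector_mult_scaleR)
  ultimately show ?thesis
    by (simp add: linear_subspace_image)
qed

lemma L_subset: "L \<subseteq> col_space X"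
  by (auto simp: restr_mean_lin_def col_space_eq_range)

lemma col_space_X_neq_UNIV: "col_space X \<noteq> UNIV"
proof
  assume "col_space X = UNIV"
  then have "rank X = CARD('n)"
    by (simp add: full_rank_surjective col_space_eq_range)
  then show False
    using rank_bound[of X] card_less by simp
qed

lemma P_props: "P *v x \<in> L\<^sup>\<bottom>" "x - P *v x \<in> L"
  using proj_mat_props[of "L\<^sup>\<bottom>" x, OF subspace_orthogonal_comp] by (simp_all add: orthogonal_comp_self subspace_L)

text \<open>Otherwise \<open>L\<close> and its complement, both inside \<open>col_space X\<close>,
  would fill the whole space. This settles limits of full rank \<open>CARD('n) - dim L\<close>,
  which \<open>\<JJ>\<close> leaves out.\<close>

lemma orthogonal_comp_L_not_subset: "\<not> L\<^sup>\<bottom> \<subseteq> col_space X"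
proof
  assume *: "L\<^sup>\<bottom> \<subseteq> col_space X"
  have "x \<in> col_space X" for x
  proof -
    have "P *v x + (x - P *v x) \<in> col_space X"
      using * P_props L_subset by (intro subspace_add subspace_col_space) blast+
    then show ?thesis by simp
  qed
  then show False using col_space_X_neq_UNIV by blast
qed

text \<open>One factor \<open>B\<close> serves all null means, all scales and all critical values: a
  draw from the null distribution differs from a nonzero multiple of \<open>B *v g\<close> only by
  \<open>X *v b\<close> and an element of \<open>L\<close>, to which the statistic is
  invariant.\<close>

lemma representation:
  assumes "pos_def_mat \<Sigma>"
  obtains B where "scaled_proj L \<Sigma> = B ** transpose B" "norm (scaled_proj L \<Sigma>) = 1"
    "\<not> col_space B \<subseteq> col_space X" "col_space B \<subseteq> L\<^sup>\<bottom>"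
    "\<And>b r \<sigma>2 C. R *v b = r \<Longrightarrow> \<sigma>2 > 0 \<Longrightarrow>
      emeasure (gaussian (X *v b) (\<sigma>2 *\<^sub>R \<Sigma>)) {y. C \<le> T r y} = emeasure \<gamma> {g. C \<le> T 0 (B *v g)}"
proof -
  obtain A where A: "\<Sigma> = A ** transpose A" "det A \<noteq> 0"
    using pos_def_factorization[OF assms] by blast
  let ?D = "P ** A"
  have tP: "transpose P = P"
    by (simp add: transpose_proj_mat subspace_orthogonal_comp)
  have D: "P ** \<Sigma> ** P = ?D ** transpose ?D"
    by (simp add: A(1) matrix_transpose_mul tP matrix_mul_assoc)
  have range_A: "\<exists>g. A *v g = x" for x
    using mult_matrix_inv_vec[OF A(2)] by blast
  have D_not_sub: "\<not> col_space ?D \<subseteq> col_space X"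
  proof
    assume *: "col_space ?D \<subseteq> col_space X"
    have "x \<in> col_space X" if "x \<in> L\<^sup>\<bottom>" for x
    proof -
      obtain g where g: "A *v g = x" using range_A by blast
      have "P *v x \<in> col_space ?D"
        unfolding g[symmetric] by (auto simp: col_space_eq_range matrix_vector_mul_assoc)
      then have "P *v x \<in> col_space X" using * by blast
      then have "P *v x + (x - P *v x) \<in> col_space X"
        using P_props(2)[of x] L_subset by (intro subspace_add subspace_col_space) blast+
      then show ?thesis by simp
    qed
    then show False using orthogonal_comp_L_not_subset by blast
  qed
  define c where "c = norm (P ** \<Sigma> ** P)"
  \<comment> \<open>The normalisation is legitimate: a zero matrix would force the range of
    \<open>P ** A\<close> to be trivial, hence inside \<open>col_space X\<close>.\<close>
  have "P ** \<Sigma> ** P \<noteq> 0"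
  proof
    assume "P ** \<Sigma> ** P = 0"
    then have "col_space ?D = col_space (0 :: real^'n^'n)"
      using D col_space_mult_transpose by metis
    also have "\<dots> \<subseteq> col_space X"
      using subspace_0[OF subspace_col_space] by (auto simp: col_space_eq_range[of 0])
    finally show False using D_not_sub by blast
  qed
  then have c: "c > 0" by (simp add: c_def)
  define B where "B = (1 / sqrt c) *\<^sub>R ?D"
  have Bg: "B *v g = (1 / sqrt c) *\<^sub>R (P *v (A *v g))" for g
    by (simp add: B_def scaleR_matrix_vector_assoc[symmetric] matrix_vector_mul_assoc)
  have sp: "scaled_proj L \<Sigma> = (P ** \<Sigma> ** P) /\<^sub>R c"
    by (simp add: scaled_proj_def Let_def c_def)
  show ?thesis
  proof (rule that[of B])
    show "scaled_proj L \<Sigma> = B ** transpose B"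
      using c unfolding sp D B_def
      by (simp add: transpose_scalar matrix_scalar_ac scalar_matrix_assoc[symmetric] inverse_eq_divide)
    show "norm (scaled_proj L \<Sigma>) = 1"
      using c by (simp add: sp c_def)
    show "col_space B \<subseteq> L\<^sup>\<bottom>"
      unfolding col_space_eq_range Bg
      by (intro image_subsetI subspace_scale subspace_orthogonal_comp P_props(1))
    show "\<not> col_space B \<subseteq> col_space X"
    proof
      assume *: "col_space B \<subseteq> col_space X"
      have "?D *v g \<in> col_space X" for g
      proof -
        have "sqrt c *\<^sub>R (B *v g) \<in> col_space X"
          using * by (intro subspace_scale subspace_col_space) (auto simp: col_space_eq_range)
        then show ?thesis using c by (simp add: Bg matrix_vector_mul_assoc)
      qed
      then show False using D_not_sub by (auto simp: col_space_eq_range[of ?D])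
    qed
  next
    fix b r and \<sigma>2 C :: real
    assume b: "R *v b = r" and s2: "\<sigma>2 > 0"
    define s where "s = sqrt \<sigma>2"
    have s: "s > 0" "s * s = \<sigma>2" using s2 by (auto simp: s_def)
    have "\<sigma>2 *\<^sub>R \<Sigma> = (s *\<^sub>R A) ** transpose (s *\<^sub>R A)"
      by (simp add: A(1) transpose_scalar matrix_scalar_ac scalar_matrix_assoc[symmetric] s)
    moreover have "(s *\<^sub>R A) ** (inverse s *\<^sub>R matrix_inv A) = mat 1"
      using s(1) by (simp add: matrix_scalar_ac scalar_matrix_assoc[symmetric] matrix_inv_inverse A(2))
    then have "det (s *\<^sub>R A) \<noteq> 0"
      by (metis det_I det_mul mult_zero_left zero_neq_one)
    ultimately have "gaussian (X *v b) (\<sigma>2 *\<^sub>R \<Sigma>) = distr \<gamma> borel (\<lambda>g. X *v b + (s *\<^sub>R A) *v g)"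
      using gaussian_eq_distr by simp
    then have "emeasure (gaussian (X *v b) (\<sigma>2 *\<^sub>R \<Sigma>)) {y. C \<le> T r y}
        = emeasure \<gamma> ((\<lambda>g. X *v b + (s *\<^sub>R A) *v g) -` {y. C \<le> T r y})"
      using measurable_T[of r] by (simp add: emeasure_distr)
    also have "(\<lambda>g. X *v b + (s *\<^sub>R A) *v g) -` {y. C \<le> T r y} = {g. C \<le> T 0 (B *v g)}"
    proof -
      have "T r (X *v b + (s *\<^sub>R A) *v g) = T 0 (B *v g)" for g
      proof -
        \<comment> \<open>The part of \<open>A *v g\<close> removed by the projection lies in
          \<open>L\<close>, so it equals \<open>X *v \<eta>\<close> with \<open>\<eta>\<close> in
          the kernel of \<open>R\<close>.\<close>
        obtain \<eta> where \<eta>: "A *v g - P *v (A *v g) = X *v \<eta>" "R *v \<eta> = 0"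
          using P_props(2)[of "A *v g"] by (auto simp: restr_mean_lin_def)
        have "(s *\<^sub>R A) *v g = s *\<^sub>R (P *v (A *v g) + (A *v g - P *v (A *v g)))"
          by (simp add: scaleR_matrix_vector_assoc[symmetric])
        also have "\<dots> = (s * sqrt c) *\<^sub>R (B *v g) + X *v (s *\<^sub>R \<eta>)"
          unfolding \<eta>(1) using c by (simp add: Bg scaleR_right_distrib matrix_vector_mult_scaleR)
        finally have "X *v b + (s *\<^sub>R A) *v g = (s * sqrt c) *\<^sub>R (B *v g) + X *v (b + s *\<^sub>R \<eta>)"
          by (simp add: matrix_vector_right_distrib)
        then show ?thesis
          using F_stat_invariant[OF b, of "s *\<^sub>R \<eta>" "s * sqrt c" "B *v g"] \<eta>(2) s(1) c
          by (simp add: matrix_vector_mult_scaleR)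
      qed
      then show ?thesis by auto
    qed
    finally show "emeasure (gaussian (X *v b) (\<sigma>2 *\<^sub>R \<Sigma>)) {y. C \<le> T r y}
        = emeasure \<gamma> {g. C \<le> T 0 (B *v g)}" .
  qed
qed

end

section \<open>Limits of factors and of the statistic\<close>

lemma restr_mean_memberD: "\<mu> \<in> restr_mean X R r \<Longrightarrow> \<exists>b. \<mu> = X *v b \<and> R *v b = r"
  by (auto simp: restr_mean_def)

lemma bounded_matrix_if_mult_transpose_normalized:
  "bounded {B :: real^'n^'n. norm (B ** transpose B) = 1}"
  unfolding bounded_iff
proof (intro exI ballI)
  fix B :: "real^'n^'n"
  assume "B \<in> {B. norm (B ** transpose B) = 1}"
  then have "(norm B)\<^sup>2 \<le> real CARD('n)"
    using norm_matrix_le_mult_transpose[of B] by simp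
  then show "norm B \<le> sqrt (real CARD('n))"
    by (rule real_le_rsqrt)
qed

context F_type_test
begin

lemma dim_orthogonal_comp_L: "dim (L\<^sup>\<bottom>) = CARD('n) - dim L"
  using dim_subspace_orthogonal_to_vectors[OF subspace_L subspace_UNIV subset_UNIV]
  by (simp add: orthogonal_comp_def)

text \<open>Bounded factors have a convergent subsequence; unit norm of the product and inclusion in
  \<open>L\<^sup>\<bottom>\<close> are closed conditions and pass to the limit. The unit norm keeps
  \<open>B'\<close> away from zero.\<close>

lemma limit_representation:
  fixes B :: "nat \<Rightarrow> real^'n^'n"
  assumes "\<And>m. norm (B m ** transpose (B m)) = 1" "\<And>m. col_space (B m) \<subseteq> L\<^sup>\<bottom>"
  obtains B' s where "strict_mono s" "(\<lambda>m. B (s m)) \<longlonglongrightarrow> B'" "norm (B' ** transpose B') = 1"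
    "(\<lambda>m. B (s m) ** transpose (B (s m))) \<longlonglongrightarrow> B' ** transpose B'" "col_space B' \<subseteq> L\<^sup>\<bottom>"
proof -
  have "bounded (range B)"
    by (rule bounded_subset[OF bounded_matrix_if_mult_transpose_normalized]) (use assms(1) in auto)
  then obtain B' s where s: "strict_mono s" "(B \<circ> s) \<longlonglongrightarrow> B'"
    using bounded_imp_convergent_subsequence by blast
  then have lim: "(\<lambda>m. B (s m)) \<longlonglongrightarrow> B'" by (simp add: o_def)
  have lim2: "(\<lambda>m. B (s m) ** transpose (B (s m))) \<longlonglongrightarrow> B' ** transpose B'"
    by (rule tendsto_mult_transpose[OF lim])
  have "(\<lambda>m. norm (B (s m) ** transpose (B (s m)))) \<longlonglongrightarrow> norm (B' ** transpose B')"
    by (rule tendsto_norm[OF lim2])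
  then have "norm (B' ** transpose B') = 1"
    unfolding assms(1) by (simp add: LIMSEQ_const_iff)
  moreover have "B' *v x \<in> L\<^sup>\<bottom>" for x
  proof (rule closed_sequentially[OF closed_subspace[OF subspace_orthogonal_comp]])
    show "B (s m) *v x \<in> L\<^sup>\<bottom>" for m
      using assms(2)[of "s m"] by (auto simp: col_space_eq_range)
    show "(\<lambda>m. B (s m) *v x) \<longlonglongrightarrow> B' *v x"
      by (intro tendsto_intros lim)
  qed
  then have "col_space B' \<subseteq> L\<^sup>\<bottom>"
    by (auto simp: col_space_eq_range)
  ultimately show ?thesis
    using that s(1) lim lim2 by blast
qed

lemma continuous_T0_tendsto:
  assumes "z \<longlonglongrightarrow> z0" "z0 \<notin> col_space X"
  shows "(\<lambda>m. T 0 (z m)) \<longlonglongrightarrow> T 0 z0"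
proof -
  have "open (- col_space X)"
    by (simp add: open_Compl closed_subspace subspace_col_space)
  then have "isCont (T 0) z0"
    using continuous_on_T0 assms(2) by (simp add: continuous_on_eq_continuous_at)
  then show ?thesis
    using assms(1) isCont_tendsto_compose by blast
qed

text \<open>Along the sequence \<open>v\<close> tends to \<open>R *v \<eta>\<close>, which is
  nonzero, while \<open>\<Omega>\<close> tends to 0, so \<open>a\<close> tends to 0. The
  Cauchy-Schwarz bound \<open>(v \<bullet> v)\<^sup>2 \<le> T * a\<close> then forces the statistic
  up.\<close>

lemma T0_unbounded:
  assumes z: "z \<longlonglongrightarrow> X *v \<eta>" "\<And>m. z m \<notin> col_space X" and \<eta>: "R *v \<eta> \<noteq> 0"
  shows "eventually (\<lambda>m. C \<le> T 0 (z m)) sequentially"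
proof -
  define v where "v m = R *v \<beta> (z m)" for m
  define a where "a m = v m \<bullet> (\<Omega> (z m) *v v m)" for m
  have b: "(\<lambda>m. \<beta> (z m)) \<longlonglongrightarrow> \<eta>"
    using continuous_on_tendsto_compose[OF continuous_est(1) z(1)] by (simp add: \<beta>_X)
  have o: "(\<lambda>m. \<Omega> (z m)) \<longlonglongrightarrow> 0"
    using continuous_on_tendsto_compose[OF continuous_est(2) z(1)] by (simp add: \<Omega>_X)
  have v: "v \<longlonglongrightarrow> R *v \<eta>"
    unfolding v_def by (intro tendsto_intros b)
  have a: "a \<longlonglongrightarrow> (R *v \<eta>) \<bullet> (0 *v (R *v \<eta>))"
    unfolding a_def by (intro tendsto_intros v o)
  \<comment> \<open>Comparing with \<open>\<bar>C\<bar> * a m\<close> avoids division by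
    \<open>a m\<close> and covers both signs of \<open>C\<close>.\<close>
  have "(\<lambda>m. (v m \<bullet> v m)\<^sup>2 - \<bar>C\<bar> * a m)
      \<longlonglongrightarrow> ((R *v \<eta>) \<bullet> (R *v \<eta>))\<^sup>2 - \<bar>C\<bar> * ((R *v \<eta>) \<bullet> (0 *v (R *v \<eta>)))"
    by (intro tendsto_intros v a)
  then have "eventually (\<lambda>m. (v m \<bullet> v m)\<^sup>2 - \<bar>C\<bar> * a m > 0) sequentially"
    by (rule order_tendstoD(1)) (use \<eta> in simp)
  moreover have "eventually (\<lambda>m. v m \<noteq> 0) sequentially"
    using tendsto_imp_eventually_ne[OF v \<eta>] .
  ultimately show ?thesis
  proof eventually_elim
    case (elim m)
    have "T 0 (z m) * a m \<ge> (v m \<bullet> v m)\<^sup>2"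
      using inner_matrix_inv_ge[OF nonneg, of "z m" "v m"] z(2)[of m] elim(2)
      by (simp add: F_stat_eq det_\<Omega>_eq_0_iff v_def a_def)
    with elim(1) have "\<bar>C\<bar> * a m < T 0 (z m) * a m" by linarith
    moreover have "a m \<ge> 0"
      using nonneg by (simp add: a_def nonneg_def_mat_def)
    ultimately have "\<bar>C\<bar> < T 0 (z m)"
      by (rule mult_right_less_imp_less)
    then show ?case by linarith
  qed
qed

lemma measurable_event [measurable]:
  fixes B :: "real^'n^'n"
  shows "{g. C \<le> T 0 (B *v g)} \<in> sets borel"
proof -
  have "(\<lambda>g. T 0 (0 + B *v g)) \<in> borel_measurable borel"
    by measurable
  then have "{g \<in> space borel. C \<le> T 0 (0 + B *v g)} \<in> sets borel"
    by (intro borel_measurable_le) simp_all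
  then show ?thesis by simp
qed

section \<open>Sufficiency of the condition\<close>

text \<open>If every critical value failed, each \<open>real m\<close> would have a factor
  \<open>B m\<close> with rejection probability above \<open>\<alpha>\<close>. Along a convergent
  subsequence these probabilities must nevertheless tend to 0.\<close>

lemma size_controllable_if:
  assumes \<CC>: "\<And>\<Sigma>. \<Sigma> \<in> \<CC> \<Longrightarrow> pos_def_mat \<Sigma>"
    and J: "\<And>S. S \<in> \<JJ> L \<CC> \<Longrightarrow> \<not> S \<subseteq> col_space X"
    and \<alpha>: "\<alpha> > 0"
  shows "\<exists>C. test_size (restr_mean X R r) \<CC> (T r) C \<le> ennreal \<alpha>"
proof (rule ccontr)
  interpret \<gamma>: prob_space \<gamma> by (rule prob_space_standard_gaussian)
  assume "\<not> ?thesis"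
  then have big: "test_size (restr_mean X R r) \<CC> (T r) C > ennreal \<alpha>" for C
    by (simp add: not_le)
  have "\<exists>B \<Sigma>. \<Sigma> \<in> \<CC> \<and> scaled_proj L \<Sigma> = B ** transpose B \<and> norm (B ** transpose B) = 1
      \<and> col_space B \<subseteq> L\<^sup>\<bottom> \<and> \<alpha> < \<gamma>.prob {g. real m \<le> T 0 (B *v g)}" for m
  proof -
    obtain \<mu> \<sigma>2 \<Sigma> where *: "\<mu> \<in> restr_mean X R r" "\<sigma>2 > 0" "\<Sigma> \<in> \<CC>"
      "ennreal \<alpha> < emeasure (gaussian \<mu> (\<sigma>2 *\<^sub>R \<Sigma>)) {y. real m \<le> T r y}"
      using big[of "real m"] unfolding test_size_def less_SUP_iff by auto
    obtain b where b: "\<mu> = X *v b" "R *v b = r"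
      using restr_mean_memberD[OF *(1)] by blast
    obtain B where B: "scaled_proj L \<Sigma> = B ** transpose B" "norm (scaled_proj L \<Sigma>) = 1"
      "col_space B \<subseteq> L\<^sup>\<bottom>"
      "emeasure (gaussian (X *v b) (\<sigma>2 *\<^sub>R \<Sigma>)) {y. real m \<le> T r y} = emeasure \<gamma> {g. real m \<le> T 0 (B *v g)}"
      using representation[OF \<CC>[OF *(3)]] b(2) *(2) by metis
    have "\<alpha> < \<gamma>.prob {g. real m \<le> T 0 (B *v g)}"
      using *(4) \<alpha> unfolding b(1) B(4) \<gamma>.emeasure_eq_measure by (simp add: ennreal_less_iff)
    with *(3) B show ?thesis by metis
  qed
  then obtain B \<Sigma> where B: "\<Sigma> m \<in> \<CC>" "scaled_proj L (\<Sigma> m) = B m ** transpose (B m)"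
    "norm (B m ** transpose (B m)) = 1" "col_space (B m) \<subseteq> L\<^sup>\<bottom>"
    "\<alpha> < \<gamma>.prob {g. real m \<le> T 0 (B m *v g)}" for m
    by metis
  obtain B' s where s: "strict_mono s" and lim: "(\<lambda>m. B (s m)) \<longlonglongrightarrow> B'"
    "(\<lambda>m. B (s m) ** transpose (B (s m))) \<longlonglongrightarrow> B' ** transpose B'"
    and B': "col_space B' \<subseteq> L\<^sup>\<bottom>"
    using limit_representation[of B, OF B(3,4)] by blast
  have "B' ** transpose B' \<in> closure (scaled_proj L ` \<CC>)"
    unfolding closure_sequential using lim(2) B(1,2)
    by (intro exI[of _ "\<lambda>m. B (s m) ** transpose (B (s m))"]) (metis imageI)
  then have in_J: "col_space B' \<in> \<JJ> L \<CC>" if "dim (col_space B') < CARD('n) - dim L"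
    using that unfolding conc_spaces_def mem_Collect_eq
    by (intro exI[of _ "B' ** transpose B'"])
      (simp add: rank_dim_range col_space_eq_range[symmetric] col_space_mult_transpose)
  \<comment> \<open>A limit of deficient rank has its range in \<open>\<JJ>\<close>, where the
    hypothesis applies; otherwise the range is all of \<open>L\<^sup>\<bottom>\<close>.\<close>
  have not_sub: "\<not> col_space B' \<subseteq> col_space X"
  proof (cases "dim (col_space B') < CARD('n) - dim L")
    case True
    then show ?thesis using in_J J by blast
  next
    case False
    then have "col_space B' = L\<^sup>\<bottom>"
      using B' by (intro subspace_dim_equal subspace_col_space subspace_orthogonal_comp)
        (simp_all add: dim_orthogonal_comp_L)
    then show ?thesis using orthogonal_comp_L_not_subset by simp
  qed
  \<comment> \<open>Almost surely the limit point avoids \<open>col_space X\<close>, so the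
    statistic converges while the thresholds \<open>real (s m)\<close> diverge.\<close>
  have "(\<lambda>m. \<gamma>.prob {g. real (s m) \<le> T 0 (B (s m) *v g)}) \<longlonglongrightarrow> 0"
  proof (rule \<gamma>.prob_tendsto_0_if_AE_eventually_notin)
    show "AE g in \<gamma>. eventually (\<lambda>m. g \<notin> {g. real (s m) \<le> T 0 (B (s m) *v g)}) sequentially"
      using AE_standard_gaussian_notin_subspace[OF subspace_col_space not_sub]
    proof eventually_elim
      case (elim g)
      have "(\<lambda>m. B (s m) *v g) \<longlonglongrightarrow> B' *v g"
        by (intro tendsto_intros lim)
      from continuous_T0_tendsto[OF this elim]
      have "eventually (\<lambda>m. T 0 (B (s m) *v g) < T 0 (B' *v g) + 1) sequentially"
        by (rule order_tendstoD) simp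
      moreover have "filterlim (\<lambda>m. real (s m)) at_top sequentially"
        by (intro filterlim_compose[OF filterlim_real_sequentially] filterlim_subseq s)
      then have "eventually (\<lambda>m. T 0 (B' *v g) + 1 \<le> real (s m)) sequentially"
        by (simp add: filterlim_at_top)
      ultimately show ?case
        by eventually_elim simp
    qed
  qed simp
  then have "\<alpha> \<le> 0"
    by (rule LIMSEQ_le_const) (use B(5) less_imp_le in blast)
  with \<alpha> show False by simp
qed

section \<open>Necessity of the condition\<close>

text \<open>For a fixed \<open>C\<close>, a size of at most \<open>\<alpha>\<close> bounds the
  rejection probability of every factor approximating the limit covariance by
  \<open>\<alpha> < 1\<close>, yet these probabilities tend to 1 along a subsequence.\<close>

lemma not_size_controllable_if:
  assumes \<CC>: "\<And>\<Sigma>. \<Sigma> \<in> \<CC> \<Longrightarrow> pos_def_mat \<Sigma>"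
    and S: "S \<in> \<JJ> L \<CC>" "S \<subseteq> col_space X"
    and \<alpha>: "0 < \<alpha>" "\<alpha> < 1"
  shows "\<not> test_size (restr_mean X R r) \<CC> (T r) C \<le> ennreal \<alpha>"
proof
  interpret \<gamma>: prob_space \<gamma> by (rule prob_space_standard_gaussian)
  assume le: "test_size (restr_mean X R r) \<CC> (T r) C \<le> ennreal \<alpha>"
  obtain b where b: "R *v b = r"
    using rank_R by (metis full_rank_surjective surjD)
  obtain \<Sigma>' where \<Sigma>': "S = col_space \<Sigma>'" "\<Sigma>' \<in> closure (scaled_proj L ` \<CC>)"
    using S(1) by (auto simp: conc_spaces_def)
  then obtain x where x: "\<And>m. x m \<in> scaled_proj L ` \<CC>" "x \<longlonglongrightarrow> \<Sigma>'"
    unfolding closure_sequential by blast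
  have "\<exists>B. x m = B ** transpose B \<and> norm (B ** transpose B) = 1 \<and> \<not> col_space B \<subseteq> col_space X
      \<and> col_space B \<subseteq> L\<^sup>\<bottom> \<and> \<gamma>.prob {g. C \<le> T 0 (B *v g)} \<le> \<alpha>" for m
  proof -
    obtain \<Sigma> where \<Sigma>: "\<Sigma> \<in> \<CC>" "x m = scaled_proj L \<Sigma>" using x(1) by blast
    obtain B where B: "scaled_proj L \<Sigma> = B ** transpose B" "norm (scaled_proj L \<Sigma>) = 1"
      "\<not> col_space B \<subseteq> col_space X" "col_space B \<subseteq> L\<^sup>\<bottom>"
      "emeasure (gaussian (X *v b) (1 *\<^sub>R \<Sigma>)) {y. C \<le> T r y} = emeasure \<gamma> {g. C \<le> T 0 (B *v g)}"
      using representation[OF \<CC>[OF \<Sigma>(1)]] b zero_less_one by metis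
    have "X *v b \<in> restr_mean X R r" using b by (auto simp: restr_mean_def)
    then have "emeasure (gaussian (X *v b) (1 *\<^sub>R \<Sigma>)) {y. C \<le> T r y}
        \<le> test_size (restr_mean X R r) \<CC> (T r) C"
      unfolding test_size_def using \<Sigma>(1)
      by (intro SUP_upper2[of "X *v b"] SUP_upper2[of "1::real"] SUP_upper2[of \<Sigma>]) auto
    then have "emeasure \<gamma> {g. C \<le> T 0 (B *v g)} \<le> ennreal \<alpha>"
      using le unfolding B(5) by (rule order_trans)
    then have "\<gamma>.prob {g. C \<le> T 0 (B *v g)} \<le> \<alpha>"
      using \<alpha>(1) by (simp add: \<gamma>.emeasure_eq_measure)
    with B \<Sigma>(2) show ?thesis by metis
  qed
  then obtain B where B: "x m = B m ** transpose (B m)" "norm (B m ** transpose (B m)) = 1"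
    "\<not> col_space (B m) \<subseteq> col_space X" "col_space (B m) \<subseteq> L\<^sup>\<bottom>"
    "\<gamma>.prob {g. C \<le> T 0 (B m *v g)} \<le> \<alpha>" for m
    by metis
  obtain B' s where s: "strict_mono s" and lim: "(\<lambda>m. B (s m)) \<longlonglongrightarrow> B'"
    "(\<lambda>m. B (s m) ** transpose (B (s m))) \<longlonglongrightarrow> B' ** transpose B'"
    and B': "norm (B' ** transpose B') = 1" "col_space B' \<subseteq> L\<^sup>\<bottom>"
    using limit_representation[of B, OF B(2,4)] by blast
  have "(\<lambda>m. x (s m)) \<longlonglongrightarrow> \<Sigma>'"
    using LIMSEQ_subseq_LIMSEQ[OF x(2) s] by (simp add: o_def)
  then have \<Sigma>'_eq: "\<Sigma>' = B' ** transpose B'"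
    using lim(2) unfolding B(1) by (rule LIMSEQ_unique)
  then have sub_X: "col_space B' \<subseteq> col_space X"
    using S(2) \<Sigma>'(1) by (simp add: col_space_mult_transpose)
  \<comment> \<open>The range of the nonzero matrix \<open>B'\<close> lies in
    \<open>L\<^sup>\<bottom>\<close>, which meets \<open>L\<close> only in 0. Hence
    \<open>B' *v g\<close> is almost surely outside \<open>L\<close>, which is what makes
    \<open>R *v \<eta>\<close> nonzero.\<close>
  have not_L: "\<not> col_space B' \<subseteq> L"
  proof
    assume "col_space B' \<subseteq> L"
    then have "col_space B' \<subseteq> {0}"
      using B'(2) orthogonal_Int_0[OF subspace_L] by blast
    then have "B' *v x = 0" for x
      by (auto simp: col_space_eq_range)
    then have "B' = 0" by (simp add: matrix_eq)
    then show False using B'(1) by simp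
  qed
  have "(\<lambda>m. \<gamma>.prob (UNIV - {g. C \<le> T 0 (B (s m) *v g)})) \<longlonglongrightarrow> 0"
  proof (rule \<gamma>.prob_tendsto_0_if_AE_eventually_notin)
    \<comment> \<open>On \<open>col_space X\<close> the statistic has the default value 0, so all
      approximating points must avoid it simultaneously; countably many null sets are
      discarded.\<close>
    have "AE g in \<gamma>. \<forall>m. B (s m) *v g \<notin> col_space X"
      unfolding AE_all_countable
      using AE_standard_gaussian_notin_subspace[OF subspace_col_space B(3)] by blast
    with AE_standard_gaussian_notin_subspace[OF subspace_L not_L]
    show "AE g in \<gamma>. eventually (\<lambda>m. g \<notin> UNIV - {g. C \<le> T 0 (B (s m) *v g)}) sequentially"
    proof eventually_elim
      case (elim g)
      obtain \<eta> where \<eta>: "B' *v g = X *v \<eta>"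
        using sub_X by (auto simp: col_space_eq_range)
      then have "R *v \<eta> \<noteq> 0"
        using elim(1) by (auto simp: restr_mean_lin_def)
      moreover have "(\<lambda>m. B (s m) *v g) \<longlonglongrightarrow> X *v \<eta>"
        unfolding \<eta>[symmetric] by (intro tendsto_intros lim)
      ultimately show ?case
        using T0_unbounded[of "\<lambda>m. B (s m) *v g" \<eta> C] elim(2) by simp
    qed
  qed simp
  moreover have "1 - \<alpha> \<le> \<gamma>.prob (UNIV - {g. C \<le> T 0 (B (s m) *v g)})" for m
    using \<gamma>.prob_compl[of "{g. C \<le> T 0 (B (s m) *v g)}"] B(5)[of "s m"] by simp
  ultimately have "1 - \<alpha> \<le> 0"
    by (intro LIMSEQ_le_const) blast+
  with \<alpha> show False by simp
qed

end

theorem corollary3p3: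
  fixes X :: "real^'k^'n" and R :: "real^'k^'q" and r :: "real^'q"
    and \<CC> :: "(real^'n^'n) set"
    and \<beta> :: "real^'n \<Rightarrow> real^'k" and \<Omega> :: "real^'n \<Rightarrow> real^'q^'q"
  assumes "CARD('k) < CARD('n)"
    and "rank X = CARD('k)"
    and "rank R = CARD('q)"
    and "covariance_model \<CC>"
    and "estimator_conditions X \<beta> \<Omega> {}"
    and "\<forall>y. nonneg_def_mat (\<Omega> y)"
    and "N_star \<Omega> {} = col_space X"
  shows "(\<forall>S \<in> \<JJ> (restr_mean_lin X R) \<CC>. \<not> S \<subseteq> col_space X) \<longleftrightarrow>
    (\<forall>\<alpha>::real. 0 < \<alpha> \<and> \<alpha> < 1 \<longrightarrow>
      (\<exists>C::real. test_size (restr_mean X R r) \<CC> (F_stat R r \<beta> \<Omega> {}) C \<le> ennreal \<alpha>))"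
proof -
  interpret F_type_test X R \<beta> \<Omega>
    using assms by unfold_locales auto
  have pd: "pos_def_mat \<Sigma>" if "\<Sigma> \<in> \<CC>" for \<Sigma>
    using assms(4) that by (simp add: covariance_model_def)
  show ?thesis
  proof (intro iffI allI impI ballI)
    fix \<alpha> :: real
    assume "\<forall>S \<in> \<JJ> L \<CC>. \<not> S \<subseteq> col_space X" "0 < \<alpha> \<and> \<alpha> < 1"
    then show "\<exists>C. test_size (restr_mean X R r) \<CC> (T r) C \<le> ennreal \<alpha>"
      by (intro size_controllable_if pd) auto
  next
    fix S
    assume "\<forall>\<alpha>. 0 < \<alpha> \<and> \<alpha> < 1 \<longrightarrow> (\<exists>C. test_size (restr_mean X R r) \<CC> (T r) C \<le> ennreal \<alpha>)"
      and S: "S \<in> \<JJ> L \<CC>"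
    \<comment> \<open>Non-controllability holds at every level in the unit interval, so one level
      suffices; one half is an arbitrary choice.\<close>
    then obtain C where "test_size (restr_mean X R r) \<CC> (T r) C \<le> ennreal (1 / 2)"
      by (auto dest: spec[of _ "1 / 2"])
    then show "\<not> S \<subseteq> col_space X"
      using not_size_controllable_if[OF pd S, of "1 / 2" r C] by auto
  qed
qed

end
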